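(* Let $n\ge 1$ agents share an identical additive valuation $v$ on a finite set $M$ of indivisible goods which is uniform, i.e. there is a constant $c>0$ such that $v(g)=c$ for every $g\in M$. Then every EF1 allocation $A$ of $M$ is NSW-optimal: $\operatorname{NSW}(A)\ge \operatorname{NSW}(B)$ for every allocation $B$ of $M$. Hence every EF1 allocation is a $1$-approximation to the optimal Nash social welfare.
   Context: An allocation is a partition $A=(A_1,\dots,A_n)$ of $M$ into $n$ pairwise disjoint (possibly empty) bundles whose union is $M$. Additive means $v(S)=\sum_{g\in S}v(g)$ for all $S\subseteq M$. The Nash social welfare is $\operatorname{NSW}(A)=\left(\prod_{i=1}^n v(A_i)\right)^{1/n}$. The allocation $A$ is EF1 (envy-free up to one good) if for every pair of agents $i,j$ with $A_j\neq\emptyset$ there exists $g\in A_j$ such that $v(A_i)\ge v(A_j\setminus\{g\})$. *)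

theory Defs
  imports Complex_Main "HOL-Library.Disjoint_Sets" "HOL-Library.FuncSet"
begin

text \<open>
  Agents are the numbers in \<open>{1..n}\<close>; the values of an allocation at other indices are irrelevant.
\<close>

definition allocation :: "nat \<Rightarrow> 'a set \<Rightarrow> (nat \<Rightarrow> 'a set) \<Rightarrow> bool" where
  "allocation n M A \<longleftrightarrow> disjoint_family_on A {1..n} \<and> (\<Union>i\<in>{1..n}. A i) = M"

definition additive_on :: "'a set \<Rightarrow> ('a set \<Rightarrow> real) \<Rightarrow> bool" where
  "additive_on M v \<longleftrightarrow> (\<forall>S\<subseteq>M. v S = (\<Sum>g\<in>S. v {g}))"

definition uniform_on :: "'a set \<Rightarrow> ('a set \<Rightarrow> real) \<Rightarrow> bool" where
  "uniform_on M v \<longleftrightarrow> (\<exists>c>0. \<forall>g\<in>M. v {g} = c)"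

definition nsw :: "nat \<Rightarrow> ('a set \<Rightarrow> real) \<Rightarrow> (nat \<Rightarrow> 'a set) \<Rightarrow> real" where
  "nsw n v A = root n (\<Prod>i\<in>{1..n}. v (A i))"

definition EF1 :: "nat \<Rightarrow> ('a set \<Rightarrow> real) \<Rightarrow> (nat \<Rightarrow> 'a set) \<Rightarrow> bool" where
  "EF1 n v A \<longleftrightarrow>
     (\<forall>i\<in>{1..n}. \<forall>j\<in>{1..n}. A j \<noteq> {} \<longrightarrow> (\<exists>g\<in>A j. v (A i) \<ge> v (A j - {g})))"

definition opt_nsw :: "nat \<Rightarrow> 'a set \<Rightarrow> ('a set \<Rightarrow> real) \<Rightarrow> real" where
  "opt_nsw n M v = Max {nsw n v B |B. allocation n M B}"

text \<open>
  The factor multiplies the optimum; for factor 1 this agrees with the convention that divides by it.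
\<close>

definition nsw_approx :: "real \<Rightarrow> nat \<Rightarrow> 'a set \<Rightarrow> ('a set \<Rightarrow> real) \<Rightarrow> (nat \<Rightarrow> 'a set) \<Rightarrow> bool" where
  "nsw_approx \<alpha> n M v A \<longleftrightarrow> allocation n M A \<and> nsw n v A \<ge> \<alpha> * opt_nsw n M v"

text \<open>
  The maximum in \<open>opt_nsw\<close> is over a finite nonempty set.
\<close>

lemma finite_nsw_values:
  assumes "finite M"
  shows "finite {nsw n v B |B. allocation n M B}"
proof (rule finite_subset)
  show "{nsw n v B |B. allocation n M B} \<subseteq> nsw n v ` ({1..n} \<rightarrow>\<^sub>E Pow M)"
  proof clarify
    fix B assume "allocation n M B"
    then have "restrict B {1..n} \<in> {1..n} \<rightarrow>\<^sub>E Pow M"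
      by (auto simp: allocation_def)
    moreover have "nsw n v B = nsw n v (restrict B {1..n})"
      by (simp add: nsw_def)
    ultimately show "nsw n v B \<in> nsw n v ` ({1..n} \<rightarrow>\<^sub>E Pow M)"
      by blast
  qed
  show "finite (nsw n v ` ({1..n} \<rightarrow>\<^sub>E Pow M))"
    using assms by (intro finite_imageI finite_PiE) auto
qed

lemma nsw_values_nonempty:
  assumes "n \<ge> 1"
  shows "{nsw n v B |B. allocation n M B} \<noteq> {}"
proof -
  have "allocation n M (\<lambda>i. if i = 1 then M else {})"
    using assms by (auto simp: allocation_def disjoint_family_on_def)
  then show ?thesis by blast
qed

end

theory Submission
  imports Defs
begin

text \<open>
  If \<open>v {g} = c\<close> for all goods, then \<open>v (A i) = c * card (A i)\<close>, and EF1 says that the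
  cardinalities \<open>card (A i)\<close> differ by at most one, so they lie in \<open>{m, m + 1}\<close> with \<open>m\<close> the
  least of them. For \<open>m > 0\<close> and \<open>r = 1 + 1 / m\<close>, every natural number \<open>k\<close> satisfies
  \<open>k \<le> m * r powi (k - m)\<close>, with equality for \<open>k = m\<close> and \<open>k = m + 1\<close>. Multiplying these bounds over
  all agents, the right-hand side depends only on the sum of the cardinalities, which is the
  same for all allocations. For \<open>m = 0\<close> there are fewer goods than agents and both
  products vanish.
\<close>

text \<open>The convex function taking x to m * r powi (x - m) meets the identity at m and m + 1, so
  it can drop below its chord only strictly between them, where no integer lies. Bernoulli's
  inequality replaces the convexity argument, and the factor \<open>r ^ m\<close> avoids negative
  exponents.\<close>

lemma chord_bound:
  fixes m k :: nat
  assumes "m > 0"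
  defines "r \<equiv> 1 + 1 / real m"
  shows "real k * r ^ m \<le> real m * r ^ k"
proof (cases "m \<le> k")
  case True
  have "1 + real (k - m) * (1 / m) \<le> r ^ (k - m)"
    unfolding r_def by (rule Bernoulli_inequality) (simp add: order.trans[of "- 1" 0])
  then have "real k \<le> real m * r ^ (k - m)"
    using assms(1) True by (simp add: field_simps of_nat_diff)
  moreover have "r ^ m \<ge> 0" by (simp add: r_def)
  ultimately have "real k * r ^ m \<le> real m * r ^ (k - m) * r ^ m"
    by (rule mult_right_mono)
  then show ?thesis
    using True by (simp add: mult.assoc flip: power_add)
next
  case False
  \<comment> \<open>\<open>s\<close> is the inverse of \<open>r\<close>, written in the shape that
    Bernoulli's inequality expects; the exponent \<open>m - k\<close> is then a natural
    number.\<close>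
  define s where "s = 1 + (- 1 / (real m + 1))"
  have "r = (real m + 1) / real m" "s = real m / (real m + 1)"
    using assms(1) by (simp_all add: r_def s_def field_simps)
  then have rs: "r * s = 1"
    using assms(1) by simp
  have "1 + real (m - k) * (- 1 / (real m + 1)) \<le> s ^ (m - k)"
    unfolding s_def by (rule Bernoulli_inequality) (simp add: field_simps)
  then have "real k + 1 \<le> (real m + 1) * s ^ (m - k)"
    using False by (simp add: field_simps of_nat_diff)
  then have "real m * (real k + 1) \<le> real m * ((real m + 1) * s ^ (m - k))"
    by (rule mult_left_mono) simp
  \<comment> \<open>Bernoulli bounds \<open>s ^ (m - k)\<close> below by (k + 1) / (m + 1), which is
    at least k / m because k < m.\<close>
  moreover have "real k * (real m + 1) \<le> real m * (real k + 1)"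
    using False by (simp add: algebra_simps)
  ultimately have "real k * (real m + 1) \<le> (real m * s ^ (m - k)) * (real m + 1)"
    by (simp add: algebra_simps)
  then have "real k \<le> real m * s ^ (m - k)"
    by (rule mult_right_le_imp_le) simp
  moreover have "r ^ m \<ge> 0" by (simp add: r_def)
  ultimately have "real k * r ^ m \<le> real m * s ^ (m - k) * r ^ m"
    by (rule mult_right_mono)
  also have "\<dots> = real m * s ^ (m - k) * (r ^ (m - k) * r ^ k)"
    using False by (simp flip: power_add)
  also have "\<dots> = real m * (r * s) ^ (m - k) * r ^ k"
    by (simp add: power_mult_distrib mult_ac)
  finally show ?thesis by (simp add: rs)
qed

text \<open>An integer form of AM-GM, obtained by multiplying the pointwise bounds of
  \<open>chord_bound\<close> instead of by exchange steps.\<close>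

lemma prod_le_prod_balanced:
  fixes a b :: "'i \<Rightarrow> nat"
  assumes "finite I"
    and sum_eq: "(\<Sum>i\<in>I. b i) = (\<Sum>i\<in>I. a i)"
    and balanced: "\<And>i j. i \<in> I \<Longrightarrow> j \<in> I \<Longrightarrow> a j \<le> a i + 1"
  shows "(\<Prod>i\<in>I. b i) \<le> (\<Prod>i\<in>I. a i)"
proof (cases "I = {}")
  case False
  define m where "m = Min (a ` I)"
  have "m \<in> a ` I"
    unfolding m_def using False assms(1) by (intro Min_in) auto
  then obtain i0 where i0: "i0 \<in> I" "a i0 = m" by auto
  have ge: "m \<le> a i" if "i \<in> I" for i
    using assms(1) that by (simp add: m_def)
  show ?thesis
  proof (cases "m = 0")
    case True
    \<comment> \<open>Balance against \<open>i0\<close> makes every \<open>a i\<close> at most 1,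
      and \<open>a i0\<close> is 0. The common sum is thus below \<open>card I\<close>, which forces
      some \<open>b i\<close> to vanish.\<close>
    have "(\<Sum>i\<in>I. a i) < (\<Sum>i\<in>I. 1)"
      by (rule sum_strict_mono_ex1) (use assms(1) balanced[OF i0(1)] i0 True in auto)
    moreover have "(\<Sum>i\<in>I. 1) \<le> (\<Sum>i\<in>I. b i)" if "\<forall>i\<in>I. b i \<noteq> 0"
      by (rule sum_mono) (use that in \<open>auto simp: Suc_le_eq\<close>)
    ultimately have "\<exists>i\<in>I. b i = 0"
      using sum_eq by fastforce
    then have "(\<Prod>i\<in>I. b i) = 0"
      using assms(1) by (simp add: prod_zero_iff)
    then show ?thesis by simp
  next
    case False
    define r where "r = 1 + 1 / real m"
    have eq: "real (a i) * r ^ m = real m * r ^ a i" if "i \<in> I" for i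
    proof -
      have "a i = m \<or> a i = m + 1"
        using ge[OF that] balanced[OF i0(1) that] i0(2) by linarith
      then show ?thesis
        using False by (auto simp: r_def field_simps)
    qed
    have "(\<Prod>i\<in>I. real (b i) * r ^ m) \<le> (\<Prod>i\<in>I. real m * r ^ b i)"
      unfolding r_def using False by (intro prod_mono conjI chord_bound) auto
    \<comment> \<open>The exponents add up, so \<open>b\<close> enters only through its sum and may
      be exchanged for \<open>a\<close>.\<close>
    also have "\<dots> = (\<Prod>i\<in>I. real m * r ^ a i)"
      by (simp add: prod.distrib sum_eq flip: power_sum)
    also have "\<dots> = (\<Prod>i\<in>I. real (a i) * r ^ m)"
      by (simp add: eq)
    finally have "real (\<Prod>i\<in>I. b i) * (r ^ m) ^ card I \<le> real (\<Prod>i\<in>I. a i) * (r ^ m) ^ card I"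
      by (simp add: prod.distrib)
    moreover have "r > 0"
      by (simp add: r_def add_pos_nonneg)
    ultimately show ?thesis
      by (simp del: of_nat_prod)
  qed
qed simp

lemma card_eq_sum_allocation:
  assumes "finite M" "allocation n M A"
  shows "(\<Sum>i\<in>{1..n}. card (A i)) = card M"
proof -
  have "card M = card (\<Union>i\<in>{1..n}. A i)"
    using assms(2) by (simp add: allocation_def)
  also have "\<dots> = (\<Sum>i\<in>{1..n}. card (A i))"
  proof (rule card_UN_disjoint)
    show "\<forall>i\<in>{1..n}. finite (A i)"
      using assms by (auto simp: allocation_def intro: finite_subset)
  qed (use assms(2) in \<open>auto simp: allocation_def disjoint_family_on_def\<close>)
  finally show ?thesis ..
qed

theorem theorem3:
  fixes n :: nat and M :: "'a set" and v :: "'a set \<Rightarrow> real" and A :: "nat \<Rightarrow> 'a set"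
  assumes "n \<ge> 1"
    and "finite M"
    and "additive_on M v"
    and "uniform_on M v"
    and "allocation n M A"
    and "EF1 n v A"
  shows "(\<forall>B. allocation n M B \<longrightarrow> nsw n v A \<ge> nsw n v B) \<and> nsw_approx 1 n M v A"
proof -
  obtain c where c: "c > 0" "\<And>g. g \<in> M \<Longrightarrow> v {g} = c"
    using assms(4) by (auto simp: uniform_on_def)
  have v: "v S = c * real (card S)" if "S \<subseteq> M" for S
  proof -
    have "v S = (\<Sum>g\<in>S. v {g})"
      using assms(3) that by (simp add: additive_on_def)
    also have "\<dots> = (\<Sum>g\<in>S. c)"
      using that c(2) by (intro sum.cong) auto
    finally show ?thesis by simp
  qed
  have sub: "B i \<subseteq> M" if "allocation n M B" "i \<in> {1..n}" for B i
    using that by (auto simp: allocation_def)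
  \<comment> \<open>Whichever good EF1 removes, the bundle loses exactly one element, so dividing by
    \<open>c\<close> leaves a statement about cardinalities.\<close>
  have balanced: "card (A j) \<le> card (A i) + 1" if ij: "i \<in> {1..n}" "j \<in> {1..n}" for i j
  proof (cases "A j = {}")
    case False
    then obtain g where g: "g \<in> A j" "v (A i) \<ge> v (A j - {g})"
      using assms(6) ij unfolding EF1_def by blast
    have "A j - {g} \<subseteq> M"
      using sub[OF assms(5) ij(2)] by auto
    then have "c * real (card (A j - {g})) \<le> c * real (card (A i))"
      using g(2) sub[OF assms(5) ij(1)] by (simp add: v)
    then have "card (A j - {g}) \<le> card (A i)"
      using c(1) by simp
    then show ?thesis
      using g(1) by (simp add: card_Diff_singleton)
  qed simp
  \<comment> \<open>The factor \<open>c ^ n\<close> is common to all allocations, so only the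
    products of cardinalities remain to be compared.\<close>
  have nsw: "nsw n v B = root n (c ^ n * real (\<Prod>i\<in>{1..n}. card (B i)))"
    if "allocation n M B" for B
  proof -
    have "(\<Prod>i\<in>{1..n}. v (B i)) = (\<Prod>i\<in>{1..n}. c * real (card (B i)))"
      by (intro prod.cong refl v sub[OF that])
    then show ?thesis
      by (simp add: nsw_def prod.distrib)
  qed
  have opt: "nsw n v B \<le> nsw n v A" if B: "allocation n M B" for B
  proof -
    have "(\<Prod>i\<in>{1..n}. card (B i)) \<le> (\<Prod>i\<in>{1..n}. card (A i))"
      using card_eq_sum_allocation[OF assms(2)] B assms(5) balanced
      by (intro prod_le_prod_balanced) auto
    then have "c ^ n * real (\<Prod>i\<in>{1..n}. card (B i)) \<le> c ^ n * real (\<Prod>i\<in>{1..n}. card (A i))"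
      using c(1) by (intro mult_left_mono) (auto simp del: of_nat_prod)
    then show ?thesis
      using assms(1) by (simp add: nsw[OF B] nsw[OF assms(5)] del: of_nat_prod)
  qed
  moreover have "opt_nsw n M v \<le> nsw n v A"
    unfolding opt_nsw_def
    by (rule Max.boundedI[OF finite_nsw_values[OF assms(2)] nsw_values_nonempty[OF assms(1)]])
      (auto intro: opt)
  ultimately show ?thesis
    using assms(5) by (simp add: nsw_approx_def)
qed

end
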